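(* Let $H$ be a bipartite graph of girth $g$ and let $\alpha$ be a $2$-edge-colouring with $(H,\alpha)$ complex-norming. Then every cycle of length $g$ in $H$ is either monochromatic under $\alpha$ or contains exactly $g/2$ edges of each colour.
   Context: $\mathcal{F}_{\mathbb{C}}$ is the complex vector space of bounded measurable $f:[0,1]^2\to\mathbb{C}$. $H$ is finite, nonempty, without isolated vertices, with fixed bipartition $A\cup B$, edges $(u,v)$, $u\in A$, $v\in B$. For $\alpha:E(H)\to\{0,1\}$, $t_{H,\alpha}(f)=\int\prod_{e=(u,v)}f(x_u,y_v)^{\alpha(e)}\overline{f(x_u,y_v)}^{1-\alpha(e)}$ (variables $x_u,y_v\in[0,1]$, Lebesgue measure); $(H,\alpha)$ is complex-norming if $|t_{H,\alpha}(\cdot)|^{1/|E(H)|}$ is a seminorm on $\mathcal{F}_{\mathbb{C}}$ vanishing only on functions $0$ a.e. *)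

theory Defs
  imports "HOL-Analysis.Analysis"
begin

text \<open>
  A bipartite graph with fixed bipartition is given by its parts \<open>A\<close>, \<open>B\<close> and its edge set
  \<open>E \<subseteq> A \<times> B\<close>: an edge is the pair \<open>(u, v)\<close> with \<open>u\<close> in \<open>A\<close> and \<open>v\<close> in \<open>B\<close>. Graphs are simple.
\<close>

definition bipartite_graph :: "'a set \<Rightarrow> 'a set \<Rightarrow> ('a \<times> 'a) set \<Rightarrow> bool" where
  "bipartite_graph A B E \<longleftrightarrow>
     finite A \<and> finite B \<and> A \<inter> B = {} \<and> A \<union> B \<noteq> {} \<and> E \<subseteq> A \<times> B \<and>
     (\<forall>w\<in>A \<union> B. \<exists>e\<in>E. w = fst e \<or> w = snd e)"

definition adjacent :: "('a \<times> 'a) set \<Rightarrow> 'a \<Rightarrow> 'a \<Rightarrow> bool" where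
  "adjacent E x y \<longleftrightarrow> (x, y) \<in> E \<or> (y, x) \<in> E"

text \<open>
  A cycle is listed by its vertices in cyclic order, the last being adjacent to the first.
\<close>

definition is_cycle :: "('a \<times> 'a) set \<Rightarrow> 'a list \<Rightarrow> bool" where
  "is_cycle E c \<longleftrightarrow>
     3 \<le> length c \<and> distinct c \<and>
     (\<forall>i<length c. adjacent E (c ! i) (c ! (Suc i mod length c)))"

definition cycle_edges :: "('a \<times> 'a) set \<Rightarrow> 'a list \<Rightarrow> ('a \<times> 'a) set" where
  "cycle_edges E c =
     {(u, v) \<in> E. \<exists>i<length c. {u, v} = {c ! i, c ! (Suc i mod length c)}}"

text \<open>The girth of a forest is \<open>\<infinity>\<close>, the infimum of the empty set.\<close>

definition girth :: "('a \<times> 'a) set \<Rightarrow> enat" where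
  "girth E = (INF c\<in>{c. is_cycle E c}. enat (length c))"

definition unit_square :: "(real \<times> real) set" where
  "unit_square = {0..1} \<times> {0..1}"

text \<open>
  Functions on the unit square are total functions on the plane; their values outside the square
  are irrelevant below. Measurability is Lebesgue measurability.
\<close>

definition F_C :: "(real \<times> real \<Rightarrow> complex) set" where
  "F_C = {f. f \<in> borel_measurable (lebesgue_on unit_square) \<and> bounded (f ` unit_square)}"

text \<open>
  Lebesgue measure on the cube with one coordinate for each element of \<open>V\<close>. The completion matters:
  for merely Lebesgue measurable \<open>f\<close>, the map taking \<open>x\<close> to \<open>f (x u, x v)\<close> need not be measurable
  with respect to the product sigma-algebra, but it is with respect to its completion.
\<close>

definition lebesgue_cube :: "'a set \<Rightarrow> ('a \<Rightarrow> real) measure" where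
  "lebesgue_cube V = completion (PiM V (\<lambda>_. lebesgue_on {0..1}))"

definition t_hom ::
    "'a set \<Rightarrow> 'a set \<Rightarrow> ('a \<times> 'a) set \<Rightarrow> ('a \<times> 'a \<Rightarrow> nat) \<Rightarrow> (real \<times> real \<Rightarrow> complex) \<Rightarrow> complex" where
  "t_hom A B E \<alpha> f =
     (LINT x|lebesgue_cube (A \<union> B).
        (\<Prod>e\<in>E. f (x (fst e), x (snd e)) ^ \<alpha> e * cnj (f (x (fst e), x (snd e))) ^ (1 - \<alpha> e)))"

definition seminorm_on :: "('b \<Rightarrow> complex) set \<Rightarrow> (('b \<Rightarrow> complex) \<Rightarrow> real) \<Rightarrow> bool" where
  "seminorm_on S p \<longleftrightarrow>
     (\<forall>f\<in>S. 0 \<le> p f) \<and>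
     (\<forall>c. \<forall>f\<in>S. p (\<lambda>z. c * f z) = cmod c * p f) \<and>
     (\<forall>f\<in>S. \<forall>h\<in>S. p (\<lambda>z. f z + h z) \<le> p f + p h)"

definition complex_norming ::
    "'a set \<Rightarrow> 'a set \<Rightarrow> ('a \<times> 'a) set \<Rightarrow> ('a \<times> 'a \<Rightarrow> nat) \<Rightarrow> bool" where
  "complex_norming A B E \<alpha> \<longleftrightarrow>
     seminorm_on F_C (\<lambda>f. cmod (t_hom A B E \<alpha> f) powr (1 / real (card E))) \<and>
     (\<forall>f\<in>F_C. cmod (t_hom A B E \<alpha> f) powr (1 / real (card E)) = 0 \<longrightarrow>
        (AE z in lebesgue_on unit_square. f z = 0))"

end

theory Submission
  imports Defs
begin

text \<open>
  Let \<open>r = \<plusminus>1\<close> be a Rademacher function, \<open>h(x, y) = r(x) r(y)\<close> and \<open>z = exp(2 \<pi> i / g)\<close>.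
  Expanding the homomorphism density of \<open>1 + \<epsilon> w h\<close> over subsets of \<open>E\<close> leaves only the edge sets
  all of whose degrees are even; the smallest nonempty ones have \<open>g\<close> edges, and the cycles of length
  \<open>g\<close> are among them. A norming density satisfies a Hoelder inequality (by the tensor power trick).
  Put \<open>1 + \<epsilon> z h\<close> on the edges of colour 1 and \<open>1 + \<epsilon> cnj(z) h\<close> on those of colour 0: after
  conjugation every edge carries \<open>1 + \<epsilon> z h\<close>, so an even set with \<open>g\<close> edges contributes
  \<open>\<epsilon>^g z^g = \<epsilon>^g\<close>. On the other side of the inequality, with \<open>1 + \<epsilon> z h\<close> everywhere, it contributes
  \<open>\<epsilon>^g z^(a - b)\<close>, where \<open>a\<close> and \<open>b\<close> count its edges of colour 1 and 0. Letting \<open>\<epsilon> \<rightarrow> 0\<close> gives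
  \<open>Re z^(a - b) = 1\<close>, that is \<open>g\<close> divides \<open>a - b\<close>, which with \<open>a + b = g\<close> leaves
  \<open>a - b \<in> {-g, 0, g}\<close>.
\<close>

subsection \<open>Even edge sets and girth\<close>

text \<open>These sets form the cycle space over GF(2). Vertices off \<open>F\<close> have degree 0,
  and the empty set qualifies: it supplies the constant 1 of the later expansion.\<close>

definition even_edges :: "('a \<times> 'a) set \<Rightarrow> bool" where
  "even_edges F \<longleftrightarrow> (\<forall>w. even (card {e \<in> F. w = fst e \<or> w = snd e}))"

text \<open>Restores the orientation of an undirected pair; when \<open>x\<close> and
  \<open>y\<close> are not adjacent, the value is the default \<open>(y, x)\<close>.\<close>

definition edge_between :: "('a \<times> 'a) set \<Rightarrow> 'a \<Rightarrow> 'a \<Rightarrow> 'a \<times> 'a" where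
  "edge_between E x y = (if (x, y) \<in> E then (x, y) else (y, x))"

lemma edge_between_in: "adjacent E x y \<Longrightarrow> edge_between E x y \<in> E"
  by (auto simp: adjacent_def edge_between_def)

lemma set_edge_between: "{fst (edge_between E x y), snd (edge_between E x y)} = {x, y}"
  by (auto simp: edge_between_def)

text \<open>Equal edges at two indices would make each index the cyclic successor of the other,
  which length at least 3 forbids. Disjoint sides leave one orientation per edge, so
  \<open>edge_between\<close> reaches every edge of the cycle.\<close>

lemma bij_betw_cycle_edges:
  assumes c: "is_cycle E c" and bip: "E \<subseteq> A \<times> B" "A \<inter> B = {}"
  shows "bij_betw (\<lambda>i. edge_between E (c ! i) (c ! (Suc i mod length c))) {..<length c} (cycle_edges E c)"
proof -
  let ?n = "length c"
  let ?e = "\<lambda>i. edge_between E (c ! i) (c ! (Suc i mod ?n))"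
  have n: "3 \<le> ?n" and d: "distinct c" and adj: "\<And>i. i < ?n \<Longrightarrow> adjacent E (c ! i) (c ! (Suc i mod ?n))"
    using c by (auto simp: is_cycle_def)
  have mod_lt: "Suc i mod ?n < ?n" for i
    using n by (intro mod_less_divisor) linarith
  have inj: "inj_on ?e {..<?n}"
  proof (rule inj_onI)
    fix i j assume ij: "i \<in> {..<?n}" "j \<in> {..<?n}" and eq: "?e i = ?e j"
    have "{c ! i, c ! (Suc i mod ?n)} = {c ! j, c ! (Suc j mod ?n)}"
      using set_edge_between[of E] eq by metis
    then have "c ! i = c ! j \<or> (c ! i = c ! (Suc j mod ?n) \<and> c ! j = c ! (Suc i mod ?n))"
      by (auto simp: doubleton_eq_iff)
    then have "i = j \<or> (i = Suc j mod ?n \<and> j = Suc i mod ?n)"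
      using ij d mod_lt by (auto simp: nth_eq_iff_index_eq)
    then show "i = j"
      using ij n by (auto simp: mod_Suc split: if_splits)
  qed
  have "?e ` {..<?n} = cycle_edges E c"
  proof
    show "?e ` {..<?n} \<subseteq> cycle_edges E c"
    proof (rule image_subsetI)
      fix i assume "i \<in> {..<?n}"
      then have i: "i < ?n"
        by simp
      show "?e i \<in> cycle_edges E c"
        using edge_between_in[OF adj[OF i]] set_edge_between[of E "c ! i" "c ! (Suc i mod ?n)"] i
        by (auto simp: cycle_edges_def split_beta)
    qed
    show "cycle_edges E c \<subseteq> ?e ` {..<?n}"
    proof
      fix p assume "p \<in> cycle_edges E c"
      then obtain u v i where p: "p = (u, v)" "(u, v) \<in> E" "i < ?n" "{u, v} = {c ! i, c ! (Suc i mod ?n)}"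
        by (auto simp: cycle_edges_def)
      have "(v, u) \<notin> E"
        using p(2) bip by blast
      then have "p = ?e i"
        using p by (auto simp: doubleton_eq_iff edge_between_def)
      then show "p \<in> ?e ` {..<?n}"
        using p by blast
    qed
  qed
  with inj show ?thesis
    by (simp add: bij_betw_def)
qed

lemma card_cycle_edges:
  assumes "is_cycle E c" "E \<subseteq> A \<times> B" "A \<inter> B = {}"
  shows "card (cycle_edges E c) = length c"
  using bij_betw_same_card[OF bij_betw_cycle_edges[OF assms]] by simp

lemma bij_betw_Suc_mod: "0 < n \<Longrightarrow> bij_betw (\<lambda>i. Suc i mod n) {..<n} {..<n}"
proof -
  assume n: "0 < n"
  have "inj_on (\<lambda>i. Suc i mod n) {..<n}"
    by (rule inj_onI) (auto simp: mod_Suc split: if_splits)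
  moreover have "(\<lambda>i. Suc i mod n) ` {..<n} \<subseteq> {..<n}"
    using n by auto
  ultimately show ?thesis
    by (simp add: bij_betw_def endo_inj_surj)
qed

text \<open>The sum form lets degrees be reindexed along a cycle; without loops at most one of the
  two indicators is 1.\<close>

lemma card_incident:
  assumes "finite F" "\<And>e. e \<in> F \<Longrightarrow> fst e \<noteq> snd e"
  shows "card {e \<in> F. w = fst e \<or> w = snd e} = (\<Sum>e\<in>F. of_bool (w = fst e) + of_bool (w = snd e))"
proof -
  have "(\<Sum>e\<in>F. of_bool (w = fst e) + of_bool (w = snd e)) = (\<Sum>e\<in>F. if w = fst e \<or> w = snd e then 1 else (0::nat))"
    by (intro sum.cong) (use assms(2) in fastforce)+
  also have "\<dots> = card {e \<in> F. w = fst e \<or> w = snd e}"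
    using assms(1) by (simp add: sum.If_cases Int_def)
  finally show ?thesis
    by simp
qed

text \<open>Each occurrence of \<open>w\<close> in the list counts once as the start and once as the
  end of a step, so the degree is twice an integer.\<close>

lemma even_edges_cycle:
  assumes c: "is_cycle E c" and bip: "E \<subseteq> A \<times> B" "A \<inter> B = {}"
  shows "even_edges (cycle_edges E c)"
  unfolding even_edges_def
proof
  fix w
  let ?n = "length c"
  let ?e = "\<lambda>i. edge_between E (c ! i) (c ! (Suc i mod length c))"
  note bij = bij_betw_cycle_edges[OF assms]
  have n: "0 < ?n"
    using c by (auto simp: is_cycle_def)
  have fin: "finite (cycle_edges E c)"
    using bij_betw_finite[OF bij] by simp
  have "card {e \<in> cycle_edges E c. w = fst e \<or> w = snd e} =
      (\<Sum>e\<in>cycle_edges E c. of_bool (w = fst e) + of_bool (w = snd e))"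
    using bip by (intro card_incident fin) (auto simp: cycle_edges_def)
  also have "\<dots> = (\<Sum>i<?n. of_bool (w = fst (?e i)) + of_bool (w = snd (?e i)))"
    by (rule sum.reindex_bij_betw[OF bij, symmetric])
  also have "\<dots> = (\<Sum>i<?n. of_bool (w = c ! i) + of_bool (w = c ! (Suc i mod ?n)))"
    by (intro sum.cong) (auto simp: edge_between_def)
  also have "\<dots> = (\<Sum>i<?n. of_bool (w = c ! i)) + (\<Sum>i<?n. of_bool (w = c ! (Suc i mod ?n)))"
    by (simp add: sum.distrib)
  also have "(\<Sum>i<?n. of_bool (w = c ! (Suc i mod ?n))) = (\<Sum>i<?n. of_bool (w = c ! i) :: nat)"
    by (rule sum.reindex_bij_betw[OF bij_betw_Suc_mod[OF n]])
  finally show "even (card {e \<in> cycle_edges E c. w = fst e \<or> w = snd e})"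
    by simp
qed

text \<open>An end vertex of a longest path has a second neighbour, which must lie on the path.\<close>

lemma exists_cycle:
  assumes fin: "finite F" and ne: "F \<noteq> {}" and bip: "F \<subseteq> A \<times> B" "A \<inter> B = {}"
    and deg: "\<And>w. card {e \<in> F. w = fst e \<or> w = snd e} \<noteq> 1"
  shows "\<exists>c. is_cycle F c"
proof -
  define V where "V = fst ` F \<union> snd ` F"
  have finV: "finite V"
    using fin by (simp add: V_def)
  have adjV: "x \<in> V \<and> y \<in> V \<and> x \<noteq> y" if "adjacent F x y" for x y
    using that bip by (force simp: adjacent_def V_def image_iff)
  \<comment> \<open>Paths with at least two vertices, so that the end \<open>x\<close> of a longest
    one has a neighbour \<open>y\<close> on it.\<close>
  define P where "P p \<longleftrightarrow> 2 \<le> length p \<and> distinct p \<and> set p \<subseteq> V \<and> successively (adjacent F) p" for p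
  obtain u v where "(u, v) \<in> F"
    using ne by auto
  then have "adjacent F u v"
    by (simp add: adjacent_def)
  then have "P [u, v]"
    using adjV[of u v] by (auto simp: P_def)
  moreover have "length p \<le> card V" if "P p" for p
    using that finV by (metis P_def card_mono distinct_card)
  ultimately obtain p where p: "P p" and max: "\<And>q. P q \<Longrightarrow> length q \<le> length p"
    using ex_has_greatest_nat[of P _ length "Suc (card V)"] by (metis le_imp_less_Suc)
  obtain x y ps where pxy: "p = x # y # ps"
    using p by (cases p; cases "tl p") (auto simp: P_def)
  have xy: "adjacent F x y"
    using p by (simp add: pxy P_def)
  obtain z where z: "adjacent F x z" "z \<noteq> y"
  proof -
    let ?I = "{e \<in> F. x = fst e \<or> x = snd e}"
    let ?e = "edge_between F x y"
    have e: "?e \<in> ?I"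
      using edge_between_in[OF xy] by (auto simp: edge_between_def)
    \<comment> \<open>The degree of \<open>x\<close> is positive because of \<open>?e\<close>, and
      it is not 1.\<close>
    have "\<not> ?I \<subseteq> {?e}"
      using deg[of x] e by (metis (no_types, lifting) card_1_singleton_iff empty_iff subset_singletonD One_nat_def)
    then obtain e' where e': "e' \<in> F" "x = fst e' \<or> x = snd e'" "e' \<noteq> ?e"
      by blast
    define z where "z = (if x = fst e' then snd e' else fst e')"
    have "adjacent F x z"
      using e' by (auto simp: z_def adjacent_def)
    moreover have "z \<noteq> y"
    proof
      assume "z = y"
      then have "e' = (x, y) \<or> e' = (y, x)"
        using e'(2) by (cases e') (auto simp: z_def split: if_splits)
      moreover have "\<not> ((x, y) \<in> F \<and> (y, x) \<in> F)"
        using bip by blast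
      ultimately show False
        using e' by (auto simp: edge_between_def)
    qed
    ultimately show ?thesis
      using that by blast
  qed
  have "z \<in> set p"
  proof (rule ccontr)
    assume "z \<notin> set p"
    moreover have "adjacent F z x"
      using z by (auto simp: adjacent_def)
    ultimately have "P (z # p)"
      using p adjV[OF z(1)] by (auto simp: P_def pxy)
    from max[OF this] show False
      by simp
  qed
  then obtain j where j: "j < length p" "p ! j = z"
    by (auto simp: in_set_conv_nth)
  have "x \<noteq> z"
    using adjV[OF z(1)] by simp
  \<comment> \<open>Neither 0, as \<open>z \<noteq> x\<close>, nor 1, as
    \<open>z \<noteq> y\<close>; closing the initial segment at \<open>z\<close> thus gives at least
    three vertices.\<close>
  then have j2: "2 \<le> j"
    using j z(2) by (cases j; cases "j - 1") (auto simp: pxy)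
  define c where "c = take (Suc j) p"
  have len: "length c = Suc j"
    using j by (simp add: c_def)
  have "adjacent F (c ! i) (c ! (Suc i mod length c))" if i: "i < length c" for i
  proof (cases "i = j")
    case True
    moreover have "c ! j = z"
      using j by (simp add: c_def)
    moreover have "c ! 0 = x"
      by (simp add: c_def pxy)
    ultimately show ?thesis
      using z(1) by (auto simp: len adjacent_def)
  next
    case False
    then have "Suc i mod length c = Suc i" "Suc i < length p"
      using i j by (auto simp: len)
    moreover have "successively (adjacent F) p"
      using p by (simp add: P_def)
    ultimately show ?thesis
      using i False by (auto simp: len c_def successively_conv_nth)
  qed
  then have "is_cycle F c"
    using j2 p by (auto simp: is_cycle_def len P_def) (simp add: c_def)
  then show ?thesis
    by blast
qed

text \<open>No degree in an even set is 1, so a nonempty one contains a cycle, which is also a cycle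
  of \<open>E\<close> and has as many edges as vertices.\<close>

lemma girth_le_card_even_edges:
  assumes "finite E" "E \<subseteq> A \<times> B" "A \<inter> B = {}" "F \<subseteq> E" "F \<noteq> {}" "even_edges F" "girth E = enat g"
  shows "g \<le> card F"
proof -
  have finF: "finite F" and bip: "F \<subseteq> A \<times> B"
    using assms finite_subset by blast+
  have "card {e \<in> F. w = fst e \<or> w = snd e} \<noteq> 1" for w
    using assms(6) unfolding even_edges_def by (metis odd_one)
  then obtain c where c: "is_cycle F c"
    using exists_cycle[OF finF assms(5) bip assms(3)] by blast
  have "is_cycle E c"
    using c assms(4) by (auto simp: is_cycle_def adjacent_def)
  then have "girth E \<le> enat (length c)"
    by (auto simp: girth_def intro: INF_lower)
  also have "length c = card (cycle_edges F c)"
    using card_cycle_edges[OF c bip assms(3)] by simp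
  also have "\<dots> \<le> card F"
    by (intro card_mono finF) (auto simp: cycle_edges_def)
  finally show ?thesis
    using assms(7) by simp
qed

subsection \<open>Densities of step functions\<close>

text \<open>The index \<open>i\<close> of the interval \<open>(i / n, (i + 1) / n]\<close> containing \<open>x\<close>; truncated subtraction
  puts \<open>x = 0\<close> into the first one.\<close>

definition cell :: "nat \<Rightarrow> real \<Rightarrow> nat" where
  "cell n x = nat \<lceil>real n * x\<rceil> - 1"

definition step :: "nat \<Rightarrow> (nat \<Rightarrow> nat \<Rightarrow> complex) \<Rightarrow> real \<times> real \<Rightarrow> complex" where
  "step n M = (\<lambda>p. M (cell n (fst p)) (cell n (snd p)))"

text \<open>A normalised weighted homomorphism count. Each edge has its own matrix, so that mixed
  densities are covered.\<close>

definition hom_density ::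
    "'a set \<Rightarrow> ('a \<times> 'a) set \<Rightarrow> nat \<Rightarrow> ('a \<times> 'a \<Rightarrow> nat \<Rightarrow> nat \<Rightarrow> complex) \<Rightarrow> complex" where
  "hom_density V E n M =
     (\<Sum>\<phi>\<in>V \<rightarrow>\<^sub>E {..<n}. \<Prod>e\<in>E. M e (\<phi> (fst e)) (\<phi> (snd e))) / of_nat n ^ card V"

text \<open>For colours in \<open>{0, 1}\<close> this is the factor of \<open>e\<close> in
  \<open>t_hom\<close>. Being a ring homomorphism in \<open>z\<close>, it commutes with sums and
  tensor products.\<close>

definition twist :: "('e \<Rightarrow> nat) \<Rightarrow> 'e \<Rightarrow> complex \<Rightarrow> complex" where
  "twist \<alpha> e z = (if \<alpha> e = 1 then z else cnj z)"

lemma cell_less: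
  assumes "0 < n" "x \<in> {0..1}"
  shows "cell n x < n"
proof -
  have "real n * x \<le> real n"
    using assms by (simp add: mult_left_le)
  then have "\<lceil>real n * x\<rceil> \<le> int n"
    by (simp add: ceiling_le_iff)
  then show ?thesis
    using assms(1) by (auto simp: cell_def)
qed

lemma measurable_cell [measurable]: "cell n \<in> borel \<rightarrow>\<^sub>M count_space UNIV"
  unfolding cell_def by measurable

lemma cell_vimage:
  assumes "i < n"
  shows "{x \<in> {0..1}. cell n x = i} =
    (if i = 0 then {0..1 / real n} else {real i / real n<..real (Suc i) / real n})"
proof -
  have n: "real n > 0"
    using assms by simp
  have i1: "real (Suc i) / real n \<le> 1"
    using assms by simp
  show ?thesis
  proof (cases "i = 0")
    case True
    have "cell n x = 0 \<longleftrightarrow> x \<le> 1 / real n" for x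
      using n by (simp add: cell_def nat_le_iff ceiling_le_iff pos_le_divide_eq mult.commute)
    then show ?thesis
      using True i1 by (auto intro: order_trans)
  next
    case False
    have "cell n x = i \<longleftrightarrow> \<lceil>real n * x\<rceil> = int i + 1" for x
      using False unfolding cell_def by linarith
    then have "cell n x = i \<longleftrightarrow> real i < real n * x \<and> real n * x \<le> real i + 1" for x
      by (simp add: ceiling_eq_iff)
    then have *: "cell n x = i \<longleftrightarrow> x \<in> {real i / real n<..real (Suc i) / real n}" for x
      using n by (simp add: pos_le_divide_eq pos_divide_less_eq mult.commute add.commute)
    have "{real i / real n<..real (Suc i) / real n} \<subseteq> {0..1}"
    proof
      fix x assume "x \<in> {real i / real n<..real (Suc i) / real n}"
      moreover have "0 \<le> real i / real n"
        by simp
      ultimately have "0 \<le> x" "x \<le> 1"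
        using i1 unfolding greaterThanAtMost_iff by linarith+
      then show "x \<in> {0..1}"
        by simp
    qed
    with * False show ?thesis
      by auto
  qed
qed

lemma measure_cell:
  assumes "i < n"
  shows "measure (lebesgue_on {0..1}) {x \<in> {0..1}. cell n x = i} = 1 / real n"
proof -
  have "measure (lebesgue_on {0..1}) {x \<in> {0..1}. cell n x = i} = measure lebesgue {x \<in> {0..1}. cell n x = i}"
    by (rule measure_restrict_space) auto
  also have "\<dots> = 1 / real n"
    unfolding cell_vimage[OF assms] using assms
    by (auto simp: divide_right_mono diff_divide_distrib[symmetric])
  finally show ?thesis .
qed

lemma step_in_F_C:
  assumes "0 < n"
  shows "step n M \<in> F_C"
proof -
  have fst: "(\<lambda>p. cell n (fst p)) \<in> (borel :: (real \<times> real) measure) \<rightarrow>\<^sub>M count_space UNIV"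
    and snd: "(\<lambda>p. cell n (snd p)) \<in> (borel :: (real \<times> real) measure) \<rightarrow>\<^sub>M count_space UNIV"
    unfolding borel_prod[symmetric] by measurable
  have "(\<lambda>p. M i (cell n (snd p))) \<in> borel_measurable (borel :: (real \<times> real) measure)" for i
    by (rule measurable_compose_countable[OF _ snd]) simp
  from measurable_compose_countable[OF this fst]
  have "step n M \<in> borel_measurable borel"
    unfolding step_def .
  then have "step n M \<in> borel_measurable (lebesgue_on unit_square)"
    by (intro measurable_restrict_space1 measurable_completion) simp
  moreover have "step n M ` unit_square \<subseteq> (\<lambda>(i, j). M i j) ` ({..<n} \<times> {..<n})"
    using cell_less[OF assms] by (auto simp: step_def unit_square_def image_iff)
  then have "bounded (step n M ` unit_square)"
    by (rule bounded_subset[rotated]) (auto intro: finite_imp_bounded)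
  ultimately show ?thesis
    by (simp add: F_C_def)
qed

text \<open>The coordinates are independent and each cell has measure \<open>1 / n\<close>, so all
  cell patterns \<open>\<phi>\<close> carry the same weight.\<close>

lemma integral_lebesgue_cube_cells:
  fixes c :: "('a \<Rightarrow> nat) \<Rightarrow> complex"
  assumes V: "finite V" and n: "0 < n"
  shows "(LINT x|lebesgue_cube V. c (\<lambda>w\<in>V. cell n (x w))) =
    (\<Sum>\<phi>\<in>V \<rightarrow>\<^sub>E {..<n}. c \<phi>) / of_nat n ^ card V"
proof -
  let ?I = "lebesgue_on {0..1::real}"
  interpret I: finite_measure ?I
    by (rule finite_measureI) (simp add: emeasure_restrict_space)
  interpret product_sigma_finite "\<lambda>_::'a. ?I"
    by standard
  define f where "f \<phi> w y = indicator {y \<in> {0..1}. cell n y = \<phi> w} y *\<^sub>R (1 :: complex)" for \<phi> :: "'a \<Rightarrow> nat" and w y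
  have meas: "{y \<in> {0..1}. cell n y = i} \<in> sets ?I" for i
  proof -
    have "cell n \<in> ?I \<rightarrow>\<^sub>M count_space UNIV"
      by (intro measurable_restrict_space1 measurable_completion) simp
    from measurable_sets[OF this, of "{i}"] have "cell n -` {i} \<inter> {0..1} \<in> sets ?I"
      by simp
    moreover have "cell n -` {i} \<inter> {0..1} = {y \<in> {0..1}. cell n y = i}"
      by auto
    ultimately show ?thesis
      by simp
  qed
  have f: "has_bochner_integral ?I (f \<phi> w) (measure ?I {y \<in> {0..1}. cell n y = \<phi> w} *\<^sub>R 1)" for \<phi> w
    unfolding f_def by (rule has_bochner_integral_indicator[OF meas]) (simp add: I.emeasure_finite less_top[symmetric])
  have int_f: "integrable ?I (f \<phi> w)" for \<phi> w
    by (rule integrable.intros[OF f])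
  have prod_int: "integrable (Pi\<^sub>M V (\<lambda>_. ?I)) (\<lambda>x. \<Prod>w\<in>V. f \<phi> w (x w))" for \<phi>
    by (rule product_integrable_prod[OF V int_f])
  \<comment> \<open>Exactly one summand survives: the pattern that records the cells of
    \<open>x\<close>.\<close>
  have eq: "c (\<lambda>w\<in>V. cell n (x w)) = (\<Sum>\<phi>\<in>V \<rightarrow>\<^sub>E {..<n}. c \<phi> * (\<Prod>w\<in>V. f \<phi> w (x w)))"
    if x: "x \<in> space (Pi\<^sub>M V (\<lambda>_. ?I))" for x
  proof -
    have x01: "x w \<in> {0..1}" if "w \<in> V" for w
      using x that by (auto simp: space_PiM PiE_def Pi_def)
    let ?\<psi> = "\<lambda>w\<in>V. cell n (x w)"
    have "(\<Prod>w\<in>V. f \<phi> w (x w)) = of_bool (\<phi> = ?\<psi>)" if \<phi>: "\<phi> \<in> V \<rightarrow>\<^sub>E {..<n}" for \<phi>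
    proof (cases "\<phi> = ?\<psi>")
      case True
      then show ?thesis
        using x01 by (auto simp: f_def intro!: prod.neutral)
    next
      case False
      have "\<exists>w\<in>V. cell n (x w) \<noteq> \<phi> w"
      proof (rule ccontr)
        assume "\<not> ?thesis"
        then have "\<phi> = ?\<psi>"
          using \<phi> by (intro extensionalityI[of _ V]) (auto simp: PiE_def)
        with False show False
          by blast
      qed
      then obtain w where "w \<in> V" "cell n (x w) \<noteq> \<phi> w"
        by blast
      then have "f \<phi> w (x w) = 0"
        by (simp add: f_def)
      then show ?thesis
        using V \<open>w \<in> V\<close> False by auto
    qed
    then have "(\<Sum>\<phi>\<in>V \<rightarrow>\<^sub>E {..<n}. c \<phi> * (\<Prod>w\<in>V. f \<phi> w (x w))) =
        (\<Sum>\<phi>\<in>V \<rightarrow>\<^sub>E {..<n}. if \<phi> = ?\<psi> then c \<phi> else 0)"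
      by (intro sum.cong) auto
    also have "\<dots> = c ?\<psi>"
      using V cell_less[OF n x01] by (subst sum.delta) (auto intro: finite_PiE)
    finally show ?thesis
      by simp
  qed
  \<comment> \<open>Measurability holds already before completion, so the completion in
    \<open>lebesgue_cube\<close> leaves the integral unchanged.\<close>
  have "(\<lambda>x. c (\<lambda>w\<in>V. cell n (x w))) \<in> borel_measurable (Pi\<^sub>M V (\<lambda>_. ?I))"
    using prod_int by (subst measurable_cong[OF eq]) (auto intro!: borel_measurable_sum)
  then have "(LINT x|lebesgue_cube V. c (\<lambda>w\<in>V. cell n (x w))) =
      (LINT x|Pi\<^sub>M V (\<lambda>_. ?I). c (\<lambda>w\<in>V. cell n (x w)))"
    unfolding lebesgue_cube_def by (rule integral_completion)
  also have "\<dots> = (LINT x|Pi\<^sub>M V (\<lambda>_. ?I). (\<Sum>\<phi>\<in>V \<rightarrow>\<^sub>E {..<n}. c \<phi> * (\<Prod>w\<in>V. f \<phi> w (x w))))"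
    by (rule Bochner_Integration.integral_cong[OF refl eq])
  also have "\<dots> = (\<Sum>\<phi>\<in>V \<rightarrow>\<^sub>E {..<n}. c \<phi> * (\<Prod>w\<in>V. integral\<^sup>L ?I (f \<phi> w)))"
    using prod_int by (simp add: product_integral_prod[OF V int_f])
  also have "\<dots> = (\<Sum>\<phi>\<in>V \<rightarrow>\<^sub>E {..<n}. c \<phi> * (1 / of_nat n) ^ card V)"
  proof (intro sum.cong refl arg_cong2[where f = "(*)"])
    fix \<phi> assume \<phi>: "\<phi> \<in> V \<rightarrow>\<^sub>E {..<n}"
    have "integral\<^sup>L ?I (f \<phi> w) = 1 / of_nat n" if "w \<in> V" for w
    proof -
      have "\<phi> w < n"
        using \<phi> that by auto
      then show ?thesis
        using has_bochner_integral_integral_eq[OF f, of \<phi> w] by (simp add: measure_cell scaleR_conv_of_real del: atLeastAtMost_iff)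
    qed
    then show "(\<Prod>w\<in>V. integral\<^sup>L ?I (f \<phi> w)) = (1 / of_nat n) ^ card V"
      by simp
  qed
  finally show ?thesis
    by (simp add: power_divide sum_divide_distrib)
qed

lemma t_hom_step:
  assumes "finite (A \<union> B)" "E \<subseteq> A \<times> B" "\<alpha> \<in> E \<rightarrow> {0, 1}" "0 < n"
  shows "t_hom A B E \<alpha> (step n M) = hom_density (A \<union> B) E n (\<lambda>e i j. twist \<alpha> e (M i j))"
proof -
  define c where "c \<phi> = (\<Prod>e\<in>E. twist \<alpha> e (M (\<phi> (fst e)) (\<phi> (snd e))))" for \<phi>
  have tw: "z ^ \<alpha> e * cnj z ^ (1 - \<alpha> e) = twist \<alpha> e z" if "e \<in> E" for e z
    using funcset_mem[OF assms(3) that] by (auto simp: twist_def)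
  have "t_hom A B E \<alpha> (step n M) = (LINT x|lebesgue_cube (A \<union> B). c (\<lambda>w\<in>A \<union> B. cell n (x w)))"
    unfolding t_hom_def c_def
    using assms(2) by (intro Bochner_Integration.integral_cong refl prod.cong) (auto simp: tw[unfolded One_nat_def] step_def)
  also have "\<dots> = hom_density (A \<union> B) E n (\<lambda>e i j. twist \<alpha> e (M i j))"
    unfolding integral_lebesgue_cube_cells[OF assms(1,4)] by (simp add: hom_density_def c_def)
  finally show ?thesis .
qed

section \<open>Tensor products and multilinearity of densities\<close>

definition tensor ::
    "nat \<Rightarrow> (nat \<Rightarrow> nat \<Rightarrow> complex) \<Rightarrow> (nat \<Rightarrow> nat \<Rightarrow> complex) \<Rightarrow> nat \<Rightarrow> nat \<Rightarrow> complex" where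
  "tensor n M N i j = M (i div n) (j div n) * N (i mod n) (j mod n)"

text \<open>The argument \<open>n ^ k\<close> is the size of the remaining power, the base in which
  \<open>tensor\<close> splits an index.\<close>

fun tensor_power :: "nat \<Rightarrow> (nat \<Rightarrow> nat \<Rightarrow> complex) \<Rightarrow> nat \<Rightarrow> nat \<Rightarrow> nat \<Rightarrow> complex" where
  "tensor_power n M 0 = (\<lambda>i j. 1)"
| "tensor_power n M (Suc k) = tensor (n ^ k) M (tensor_power n M k)"

text \<open>By division with remainder, an assignment into \<open>m * n\<close> values is a pair of
  assignments, into \<open>m\<close> and into \<open>n\<close> values, and the sum over pairs
  factors.\<close>

lemma hom_density_tensor:
  assumes "V = fst ` E \<union> snd ` E" and n: "0 < n"
  shows "hom_density V E (m * n) (\<lambda>e. tensor n (M e) (N e)) = hom_density V E m M * hom_density V E n N"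
proof -
  let ?P = "\<lambda>M \<phi>. \<Prod>e\<in>E. M e (\<phi> (fst e)) (\<phi> (snd e)) :: complex"
  have V: "fst e \<in> V" "snd e \<in> V" if "e \<in> E" for e
    using assms(1) that by auto
  have comb: "a * n + b < m * n" if "a < m" "b < n" for a b
  proof -
    have "a * n + b < Suc a * n"
      using that by simp
    also have "\<dots> \<le> m * n"
      using that by (intro mult_right_mono) auto
    finally show ?thesis .
  qed
  have "(\<Sum>\<phi>\<in>V \<rightarrow>\<^sub>E {..<m}. ?P M \<phi>) * (\<Sum>\<phi>\<in>V \<rightarrow>\<^sub>E {..<n}. ?P N \<phi>) =
      (\<Sum>(\<phi>, \<psi>)\<in>(V \<rightarrow>\<^sub>E {..<m}) \<times> (V \<rightarrow>\<^sub>E {..<n}). ?P M \<phi> * ?P N \<psi>)"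
    by (simp add: sum_product sum.cartesian_product)
  also have "\<dots> = (\<Sum>\<omega>\<in>V \<rightarrow>\<^sub>E {..<m * n}. ?P (\<lambda>e. tensor n (M e) (N e)) \<omega>)"
  proof (rule sum.reindex_bij_witness[where
        i = "\<lambda>\<omega>. (\<lambda>w\<in>V. \<omega> w div n, \<lambda>w\<in>V. \<omega> w mod n)" and
        j = "\<lambda>(\<phi>, \<psi>). \<lambda>w\<in>V. \<phi> w * n + \<psi> w"])
    fix p assume "p \<in> (V \<rightarrow>\<^sub>E {..<m}) \<times> (V \<rightarrow>\<^sub>E {..<n})"
    then obtain \<phi> \<psi> where p: "p = (\<phi>, \<psi>)" "\<phi> \<in> V \<rightarrow>\<^sub>E {..<m}" "\<psi> \<in> V \<rightarrow>\<^sub>E {..<n}"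
      by auto
    have lt: "\<psi> w < n" if "w \<in> V" for w
      using p that by auto
    show "(\<lambda>\<omega>. (\<lambda>w\<in>V. \<omega> w div n, \<lambda>w\<in>V. \<omega> w mod n)) (case p of (\<phi>, \<psi>) \<Rightarrow> \<lambda>w\<in>V. \<phi> w * n + \<psi> w) = p"
      using p n lt by (auto simp: fun_eq_iff PiE_def extensional_def)
    show "(case p of (\<phi>, \<psi>) \<Rightarrow> \<lambda>w\<in>V. \<phi> w * n + \<psi> w) \<in> V \<rightarrow>\<^sub>E {..<m * n}"
      using p comb by (auto simp: PiE_def Pi_def)
    show "?P (\<lambda>e. tensor n (M e) (N e)) (case p of (\<phi>, \<psi>) \<Rightarrow> \<lambda>w\<in>V. \<phi> w * n + \<psi> w) =
        (case p of (\<phi>, \<psi>) \<Rightarrow> ?P M \<phi> * ?P N \<psi>)"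
      using n V lt by (simp add: p(1) prod.distrib[symmetric] tensor_def)
  next
    fix \<omega> assume \<omega>: "\<omega> \<in> V \<rightarrow>\<^sub>E {..<m * n}"
    show "(case (\<lambda>w\<in>V. \<omega> w div n, \<lambda>w\<in>V. \<omega> w mod n) of (\<phi>, \<psi>) \<Rightarrow> \<lambda>w\<in>V. \<phi> w * n + \<psi> w) = \<omega>"
      using \<omega> by (auto simp: fun_eq_iff PiE_def extensional_def)
    show "(\<lambda>w\<in>V. \<omega> w div n, \<lambda>w\<in>V. \<omega> w mod n) \<in> (V \<rightarrow>\<^sub>E {..<m}) \<times> (V \<rightarrow>\<^sub>E {..<n})"
      using \<omega> n by (auto simp: PiE_def Pi_def less_mult_imp_div_less)
  qed
  finally show ?thesis
    by (simp add: hom_density_def power_mult_distrib)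
qed

lemma hom_density_tensor_power:
  assumes "V = fst ` E \<union> snd ` E" and "0 < n"
  shows "hom_density V E (n ^ k) (\<lambda>e. tensor_power n (M e) k) = hom_density V E n M ^ k"
proof (induction k)
  case 0
  have "V \<rightarrow>\<^sub>E {..<1::nat} = {\<lambda>w\<in>V. 0}"
    by (auto simp: PiE_def extensional_def fun_eq_iff Pi_def)
  then show ?case
    by (simp add: hom_density_def)
next
  case (Suc k)
  have "0 < n ^ k"
    using assms(2) by simp
  from hom_density_tensor[OF assms(1) this, of n M] Suc show ?case
    by simp
qed

lemma hom_density_cnj: "hom_density V E n (\<lambda>e i j. cnj (M e i j)) = cnj (hom_density V E n M)"
  by (simp add: hom_density_def)

text \<open>Distributing the product over the edges: \<open>\<sigma>\<close> selects the summand
  used at each edge, so every mixed density appears once.\<close>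

lemma hom_density_sum:
  assumes "finite E" "finite I"
  shows "hom_density V E n (\<lambda>e i j. \<Sum>s\<in>I. M s e i j) =
    (\<Sum>\<sigma>\<in>E \<rightarrow>\<^sub>E I. hom_density V E n (\<lambda>e. M (\<sigma> e) e))"
proof -
  have "(\<Sum>\<phi>\<in>V \<rightarrow>\<^sub>E {..<n}. \<Prod>e\<in>E. \<Sum>s\<in>I. M s e (\<phi> (fst e)) (\<phi> (snd e))) =
      (\<Sum>\<phi>\<in>V \<rightarrow>\<^sub>E {..<n}. \<Sum>\<sigma>\<in>E \<rightarrow>\<^sub>E I. \<Prod>e\<in>E. M (\<sigma> e) e (\<phi> (fst e)) (\<phi> (snd e)))"
    using assms by (simp add: prod_sum_PiE)
  also have "\<dots> = (\<Sum>\<sigma>\<in>E \<rightarrow>\<^sub>E I. \<Sum>\<phi>\<in>V \<rightarrow>\<^sub>E {..<n}. \<Prod>e\<in>E. M (\<sigma> e) e (\<phi> (fst e)) (\<phi> (snd e)))"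
    by (rule sum.swap)
  finally show ?thesis
    by (simp add: hom_density_def sum_divide_distrib)
qed

lemma twist_mult: "twist \<alpha> e (y * z) = twist \<alpha> e y * twist \<alpha> e z"
  by (simp add: twist_def)

lemma twist_cnj: "twist \<alpha> e (cnj z) = cnj (twist \<alpha> e z)"
  by (simp add: twist_def)

lemma twist_sum: "twist \<alpha> e (\<Sum>s\<in>I. f s) = (\<Sum>s\<in>I. twist \<alpha> e (f s))"
  by (simp add: twist_def)

lemma twist_tensor: "twist \<alpha> e (tensor n M N i j) = tensor n (\<lambda>i j. twist \<alpha> e (M i j)) (\<lambda>i j. twist \<alpha> e (N i j)) i j"
  by (simp add: tensor_def twist_mult)

lemma twist_tensor_power: "twist \<alpha> e (tensor_power n M k i j) = tensor_power n (\<lambda>i j. twist \<alpha> e (M i j)) k i j"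
proof (induction k arbitrary: i j)
  case 0
  then show ?case
    by (simp add: twist_def)
next
  case (Suc k)
  then show ?case
    by (simp add: tensor_def twist_mult)
qed

subsection \<open>A Hoelder inequality\<close>

text \<open>\<open>C\<close> does not depend on \<open>k\<close>: if \<open>y < x\<close>, then
  \<open>(y / x) ^ (2 * k)\<close> eventually falls below \<open>1 / C\<close>.\<close>

lemma le_of_power_le_const_mult:
  fixes x y C :: real
  assumes "0 \<le> x" "0 \<le> y" and le: "\<And>k. x ^ (2 * k) \<le> C * y ^ (2 * k)"
  shows "x \<le> y"
proof (rule ccontr)
  assume "\<not> x \<le> y"
  then have x: "y < x" "0 < x"
    using assms by auto
  \<comment> \<open>Exponent 0 already bounds \<open>C\<close> from below.\<close>
  have C: "1 \<le> C"
    using le[of 0] by simp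
  have "(y / x)\<^sup>2 < 1"
    using x assms(2) by (simp add: power_less_one_iff abs_square_less_1)
  then obtain k where k: "((y / x)\<^sup>2) ^ k < 1 / C"
    using real_arch_pow_inv[of "1 / C" "(y / x)\<^sup>2"] C by auto
  have "C * y ^ (2 * k) < x ^ (2 * k)"
    unfolding power_mult using k C x by (simp add: power_divide pos_divide_less_eq pos_less_divide_eq mult.commute flip: power_mult)
  with le[of k] show False
    by simp
qed

lemma powr_inverse_power:
  fixes x :: real
  assumes "0 \<le> x" "0 < c"
  shows "(x powr (1 / real c)) ^ c = x"
proof (cases "x = 0")
  case True
  then show ?thesis
    using assms by simp
next
  case False
  then have "(x powr (1 / real c)) ^ c = x powr (1 / real c * real c)"
    using assms by (simp add: powr_realpow[symmetric] powr_powr)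
  then show ?thesis
    using False assms by simp
qed

lemma seminorm_on_step_sum:
  assumes p: "seminorm_on F_C p" and m: "0 < m" and I: "finite I"
  shows "p (step m (\<lambda>i j. \<Sum>s\<in>I. G s i j)) \<le> (\<Sum>s\<in>I. p (step m (G s)))"
  using I
proof induction
  case empty
  \<comment> \<open>Writing the zero function as a multiple by 0 lets homogeneity show that its
    seminorm is 0.\<close>
  have "p (\<lambda>z. 0 * step m (\<lambda>i j. 0) z) = cmod 0 * p (step m (\<lambda>i j. 0))"
    using p step_in_F_C[OF m] unfolding seminorm_on_def by blast
  then show ?case
    by (simp add: step_def)
next
  case (insert s I)
  have "p (\<lambda>z. step m (G s) z + step m (\<lambda>i j. \<Sum>s\<in>I. G s i j) z)
      \<le> p (step m (G s)) + p (step m (\<lambda>i j. \<Sum>s\<in>I. G s i j))"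
    using p step_in_F_C[OF m] unfolding seminorm_on_def by blast
  moreover have "(\<lambda>z. step m (G s) z + step m (\<lambda>i j. \<Sum>s\<in>I. G s i j) z) = step m (\<lambda>i j. \<Sum>s\<in>insert s I. G s i j)"
    using insert by (simp add: step_def fun_eq_iff)
  ultimately show ?case
    using insert by simp
qed

text \<open>The tensor power trick: replacing every \<open>M s\<close> by a tensor power of \<open>M s\<close> tensored with its
  conjugate makes all mixed densities nonnegative, so each of them is bounded by the density of the
  sum, to which the triangle inequality applies. The constant lost disappears in the limit.\<close>

lemma hom_density_mixed_le:
  assumes G: "bipartite_graph A B E" and \<alpha>: "\<alpha> \<in> E \<rightarrow> {0, 1}"
    and semi: "seminorm_on F_C (\<lambda>f. cmod (t_hom A B E \<alpha> f) powr (1 / real (card E)))"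
    and n: "0 < n" and I: "finite I" and \<sigma>: "\<And>e. e \<in> E \<Longrightarrow> \<sigma> e \<in> I"
    and L: "\<And>s. s \<in> I \<Longrightarrow> cmod (hom_density (A \<union> B) E n (\<lambda>e i j. twist \<alpha> e (M s i j))) \<le> L"
  shows "cmod (hom_density (A \<union> B) E n (\<lambda>e i j. twist \<alpha> e (M (\<sigma> e) i j))) \<le> L"
proof -
  let ?V = "A \<union> B"
  let ?p = "\<lambda>f. cmod (t_hom A B E \<alpha> f) powr (1 / real (card E))"
  \<comment> \<open>\<open>\<tau>\<close> names the matrix on each edge: constant
    \<open>\<tau>\<close> gives the densities bounded by \<open>L\<close>, and
    \<open>\<sigma>\<close> the one to be bounded.\<close>
  define D where "D \<tau> = hom_density ?V E n (\<lambda>e i j. twist \<alpha> e (M (\<tau> e) i j))" for \<tau>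
  have finV: "finite ?V" and EAB: "E \<subseteq> A \<times> B"
    using G by (auto simp: bipartite_graph_def)
  have finE: "finite E"
    using G by (auto simp: bipartite_graph_def intro: finite_subset)
  have V: "?V = fst ` E \<union> snd ` E"
  proof
    show "?V \<subseteq> fst ` E \<union> snd ` E"
      using G unfolding bipartite_graph_def by blast
    show "fst ` E \<union> snd ` E \<subseteq> ?V"
      using EAB by auto
  qed
  have E: "E \<noteq> {}"
    using G by (auto simp: bipartite_graph_def)
  then have c: "0 < card E"
    using finE by (simp add: card_gt_0_iff)
  obtain e0 where "e0 \<in> E"
    using E by auto
  from order_trans[OF norm_ge_zero L[OF \<sigma>[OF this]]] have L0: "0 \<le> L" .
  have "cmod (D \<sigma>) ^ (2 * k) \<le> real (card I) ^ card E * L ^ (2 * k)" for k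
  proof -
    define m where "m = (n * n) ^ k"
    define Q where "Q s = tensor n (M s) (\<lambda>i j. cnj (M s i j))" for s
    define H where "H s = tensor_power (n * n) (Q s) k" for s
    have m: "0 < m"
      using n by (simp add: m_def)
    have mixed: "hom_density ?V E m (\<lambda>e i j. twist \<alpha> e (H (\<tau> e) i j)) = of_real (cmod (D \<tau>) ^ (2 * k))" for \<tau>
    proof -
      have "hom_density ?V E m (\<lambda>e i j. twist \<alpha> e (H (\<tau> e) i j)) =
          hom_density ?V E (n * n) (\<lambda>e i j. twist \<alpha> e (Q (\<tau> e) i j)) ^ k"
        using hom_density_tensor_power[OF V, of "n * n" k "\<lambda>e i j. twist \<alpha> e (Q (\<tau> e) i j)"] n
        by (simp add: m_def H_def twist_tensor_power)
      also have "hom_density ?V E (n * n) (\<lambda>e i j. twist \<alpha> e (Q (\<tau> e) i j)) = D \<tau> * cnj (D \<tau>)"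
        using hom_density_tensor[OF V n, of n "\<lambda>e i j. twist \<alpha> e (M (\<tau> e) i j)" "\<lambda>e i j. cnj (twist \<alpha> e (M (\<tau> e) i j))"]
        by (simp add: Q_def twist_tensor twist_cnj hom_density_cnj D_def)
      also have "\<dots> = of_real ((cmod (D \<tau>))\<^sup>2)"
        by (rule complex_norm_square[symmetric])
      finally show ?thesis
        by (simp add: power_mult)
    qed
    have t: "t_hom A B E \<alpha> (step m (H s)) = of_real (cmod (D (\<lambda>_. s)) ^ (2 * k))" for s
      using mixed[of "\<lambda>_. s"] by (simp add: t_hom_step[OF finV EAB \<alpha> m])
    have "t_hom A B E \<alpha> (step m (\<lambda>i j. \<Sum>s\<in>I. H s i j)) =
        (\<Sum>\<tau>\<in>E \<rightarrow>\<^sub>E I. hom_density ?V E m (\<lambda>e i j. twist \<alpha> e (H (\<tau> e) i j)))"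
      using hom_density_sum[OF finE I, of ?V m "\<lambda>s e i j. twist \<alpha> e (H s i j)"]
      by (simp add: t_hom_step[OF finV EAB \<alpha> m] twist_sum)
    also have "\<dots> = of_real (\<Sum>\<tau>\<in>E \<rightarrow>\<^sub>E I. cmod (D \<tau>) ^ (2 * k))"
      by (simp add: mixed)
    finally have tsum: "t_hom A B E \<alpha> (step m (\<lambda>i j. \<Sum>s\<in>I. H s i j)) =
        of_real (\<Sum>\<tau>\<in>E \<rightarrow>\<^sub>E I. cmod (D \<tau>) ^ (2 * k))" (is "?t = of_real ?S") .
    \<comment> \<open>\<open>\<sigma>\<close> is arbitrary off \<open>E\<close>; only its
      restriction is one of the summation indices.\<close>
    have D\<sigma>: "D \<sigma> = D (restrict \<sigma> E)"
      unfolding D_def hom_density_def by simp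
    have "cmod (D \<sigma>) ^ (2 * k) \<le> ?S"
      unfolding D\<sigma> using \<sigma> finE I by (intro member_le_sum) (auto intro: finite_PiE)
    also have S0: "0 \<le> ?S"
      by (intro sum_nonneg) simp
    then have "?S = (?p (step m (\<lambda>i j. \<Sum>s\<in>I. H s i j))) ^ card E"
      unfolding tsum by (simp only: norm_of_real abs_of_nonneg powr_inverse_power[OF S0 c])
    also have "\<dots> \<le> (\<Sum>s\<in>I. ?p (step m (H s))) ^ card E"
      by (intro power_mono seminorm_on_step_sum[OF semi m I]) simp
    also have "\<dots> \<le> (real (card I) * (L ^ (2 * k)) powr (1 / real (card E))) ^ card E"
    proof (intro power_mono sum_bounded_above sum_nonneg)
      fix s assume "s \<in> I"
      then have "cmod (D (\<lambda>_. s)) \<le> L"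
        using L by (simp add: D_def)
      then show "?p (step m (H s)) \<le> (L ^ (2 * k)) powr (1 / real (card E))"
        unfolding t by (intro powr_mono2) (auto simp: norm_power intro: power_mono)
    qed simp
    \<comment> \<open>The factor in front of the power of \<open>L\<close> is independent of
      \<open>k\<close>, as the limit argument requires.\<close>
    also have "\<dots> = real (card I) ^ card E * L ^ (2 * k)"
      using L0 c by (simp add: power_mult_distrib powr_inverse_power)
    finally show ?thesis .
  qed
  then have "cmod (D \<sigma>) \<le> L"
    by (intro le_of_power_le_const_mult[OF norm_ge_zero L0])
  then show ?thesis
    by (simp add: D_def)
qed

subsection \<open>Expansion around the constant function\<close>

text \<open>Grouping the signs by vertex gives each \<open>w\<close> its degree in \<open>F\<close>
  as exponent. The sum then factors into terms \<open>1 + (- 1) ^ d w\<close>, each 2 or 0.\<close>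

lemma rademacher_average:
  assumes "finite V" "finite F" "fst ` F \<union> snd ` F \<subseteq> V" "\<And>e. e \<in> F \<Longrightarrow> fst e \<noteq> snd e"
  shows "(\<Sum>\<phi>\<in>V \<rightarrow>\<^sub>E {..<2::nat}. \<Prod>e\<in>F. (- 1) ^ \<phi> (fst e) * (- 1) ^ \<phi> (snd e)) =
    (if even_edges F then 2 ^ card V else 0 :: complex)"
proof -
  define d where "d w = card {e \<in> F. w = fst e \<or> w = snd e}" for w
  have "(\<Prod>e\<in>F. (- 1) ^ \<phi> (fst e) * (- 1) ^ \<phi> (snd e)) = (\<Prod>w\<in>V. ((- 1) ^ \<phi> w) ^ d w :: complex)"
    for \<phi> :: "'a \<Rightarrow> nat"
  proof -
    have "(\<Prod>e\<in>F. (- 1) ^ \<phi> (fst e) * (- 1) ^ \<phi> (snd e) :: complex) =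
        (\<Prod>e\<in>F. \<Prod>w\<in>V. if w = fst e \<or> w = snd e then (- 1) ^ \<phi> w else 1)"
    proof (rule prod.cong)
      fix e assume e: "e \<in> F"
      have "(\<Prod>w\<in>V. if w = fst e \<or> w = snd e then (- 1) ^ \<phi> w else 1 :: complex) =
          (\<Prod>w\<in>{fst e, snd e}. if w = fst e \<or> w = snd e then (- 1) ^ \<phi> w else 1)"
        using assms(1,3) e by (intro prod.mono_neutral_right) auto
      also have "\<dots> = (- 1) ^ \<phi> (fst e) * (- 1) ^ \<phi> (snd e)"
        using assms(4)[OF e] by simp
      finally show "(- 1) ^ \<phi> (fst e) * (- 1) ^ \<phi> (snd e) =
          (\<Prod>w\<in>V. if w = fst e \<or> w = snd e then (- 1) ^ \<phi> w else 1 :: complex)" ..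
    qed simp
    also have "\<dots> = (\<Prod>w\<in>V. \<Prod>e\<in>F. if w = fst e \<or> w = snd e then (- 1) ^ \<phi> w else 1)"
      by (rule prod.swap)
    also have "\<dots> = (\<Prod>w\<in>V. ((- 1) ^ \<phi> w) ^ d w)"
      using assms(2) by (simp add: prod.If_cases Int_def d_def)
    finally show ?thesis .
  qed
  then have "(\<Sum>\<phi>\<in>V \<rightarrow>\<^sub>E {..<2::nat}. \<Prod>e\<in>F. (- 1) ^ \<phi> (fst e) * (- 1) ^ \<phi> (snd e)) =
      (\<Prod>w\<in>V. \<Sum>i<2::nat. ((- 1) ^ i) ^ d w :: complex)"
    using assms(1) by (simp add: prod_sum_PiE)
  also have "\<dots> = (\<Prod>w\<in>V. if even (d w) then 2 else 0)"
    by (intro prod.cong) (auto simp: numeral_2_eq_2)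
  also have "\<dots> = (if even_edges F then 2 ^ card V else 0)"
  proof (cases "even_edges F")
    case True
    then show ?thesis
      by (simp add: even_edges_def d_def)
  next
    case False
    then obtain w where w: "odd (d w)"
      by (auto simp: even_edges_def d_def)
    then have "{e \<in> F. w = fst e \<or> w = snd e} \<noteq> {}"
      unfolding d_def by (metis card.empty even_zero)
    \<comment> \<open>An odd degree is not 0, so \<open>w\<close> is an endpoint and its vanishing
      factor does occur.\<close>
    then have "w \<in> V"
      using assms(3) by auto
    with w False assms(1) show ?thesis
      by auto
  qed
  finally show ?thesis .
qed

text \<open>Index 0 has sign 1 and index 1 has sign -1, so the sign matrix is \<open>h\<close> on
  the two halves of the interval. The product expands over subsets of \<open>E\<close>, and
  averaging keeps the even ones.\<close>

lemma hom_density_rademacher: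
  assumes "finite V" "finite E" "fst ` E \<union> snd ` E \<subseteq> V" "\<And>e. e \<in> E \<Longrightarrow> fst e \<noteq> snd e"
  shows "hom_density V E 2 (\<lambda>e i j. 1 + x e * ((- 1) ^ i * (- 1) ^ j)) =
    (\<Sum>F | F \<subseteq> E \<and> even_edges F. \<Prod>e\<in>F. x e)"
proof -
  let ?s = "\<lambda>\<phi> e. (- 1) ^ \<phi> (fst e) * (- 1) ^ \<phi> (snd e) :: complex"
  have "(\<Sum>\<phi>\<in>V \<rightarrow>\<^sub>E {..<2::nat}. \<Prod>e\<in>E. 1 + x e * ?s \<phi> e) =
      (\<Sum>\<phi>\<in>V \<rightarrow>\<^sub>E {..<2::nat}. \<Sum>F\<in>Pow E. \<Prod>e\<in>F. x e * ?s \<phi> e)"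
    by (subst add.commute, subst prod_add[OF assms(2)]) simp
  also have "\<dots> = (\<Sum>F\<in>Pow E. \<Sum>\<phi>\<in>V \<rightarrow>\<^sub>E {..<2::nat}. \<Prod>e\<in>F. x e * ?s \<phi> e)"
    by (rule sum.swap)
  also have "\<dots> = (\<Sum>F\<in>Pow E. (\<Prod>e\<in>F. x e) * (if even_edges F then 2 ^ card V else 0))"
  proof (rule sum.cong)
    fix F assume "F \<in> Pow E"
    then have FE: "F \<subseteq> E"
      by simp
    have F: "finite F" "fst ` F \<union> snd ` F \<subseteq> V" "\<And>e. e \<in> F \<Longrightarrow> fst e \<noteq> snd e"
      using FE assms finite_subset[OF FE assms(2)] by blast+
    have "(\<Sum>\<phi>\<in>V \<rightarrow>\<^sub>E {..<2::nat}. \<Prod>e\<in>F. x e * ?s \<phi> e) = (\<Prod>e\<in>F. x e) * (\<Sum>\<phi>\<in>V \<rightarrow>\<^sub>E {..<2::nat}. \<Prod>e\<in>F. ?s \<phi> e)"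
      by (simp only: prod.distrib[of x] sum_distrib_left)
    then show "(\<Sum>\<phi>\<in>V \<rightarrow>\<^sub>E {..<2::nat}. \<Prod>e\<in>F. x e * ?s \<phi> e) = (\<Prod>e\<in>F. x e) * (if even_edges F then 2 ^ card V else 0)"
      by (simp only: rademacher_average[OF assms(1) F])
  qed simp
  also have "\<dots> = (\<Sum>F\<in>Pow E. if even_edges F then (\<Prod>e\<in>F. x e) * 2 ^ card V else 0)"
    by (intro sum.cong) auto
  also have "\<dots> = (\<Sum>F | F \<subseteq> E \<and> even_edges F. (\<Prod>e\<in>F. x e) * 2 ^ card V)"
    using assms(2) by (simp add: sum.If_cases Int_def)
  finally show ?thesis
    by (simp add: hom_density_def sum_distrib_right[symmetric])
qed

text \<open>Squared, both sides read
  \<open>1 + 2 \<epsilon>^g Re P + \<epsilon>^(2 g) |P|^2\<close>, where \<open>P\<close> tends to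
  the sum of the coefficients with exponent \<open>g\<close>. Subtract 1, divide by
  \<open>\<epsilon>^g\<close> and let \<open>\<epsilon>\<close> tend to 0 from the right.\<close>

lemma Re_leading_coeff_le:
  fixes a b :: "'i \<Rightarrow> complex" and N :: "'i \<Rightarrow> nat"
  assumes finS: "finite S" and "0 < g" and N: "\<And>i. i \<in> S \<Longrightarrow> g \<le> N i"
    and le: "\<And>\<epsilon>::real. 0 < \<epsilon> \<Longrightarrow>
      cmod (1 + (\<Sum>i\<in>S. of_real \<epsilon> ^ N i * a i)) \<le> cmod (1 + (\<Sum>i\<in>S. of_real \<epsilon> ^ N i * b i))"
  shows "(\<Sum>i | i \<in> S \<and> N i = g. Re (a i)) \<le> (\<Sum>i | i \<in> S \<and> N i = g. Re (b i))"
proof -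
  \<comment> \<open>The sum divided by \<open>\<epsilon> ^ g\<close>; the truncated subtraction is
    exact because no exponent is below \<open>g\<close>.\<close>
  define P where "P c \<epsilon> = (\<Sum>i\<in>S. of_real \<epsilon> ^ (N i - g) * c i)" for c :: "'i \<Rightarrow> complex" and \<epsilon> :: real
  have P0: "Re (P c 0) = (\<Sum>i | i \<in> S \<and> N i = g. Re (c i))" for c
  proof -
    have "Re (P c 0) = (\<Sum>i\<in>S. if N i = g then Re (c i) else 0)"
      unfolding P_def Re_sum
    proof (rule sum.cong)
      fix i assume "i \<in> S"
      then have "N i - g = 0 \<longleftrightarrow> N i = g"
        using N[of i] by auto
      then show "Re (of_real 0 ^ (N i - g) * c i) = (if N i = g then Re (c i) else 0)"
        by (simp add: power_0_left)
    qed simp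
    also have "\<dots> = (\<Sum>i | i \<in> S \<and> N i = g. Re (c i))"
      using finS by (simp add: sum.If_cases Int_def)
    finally show ?thesis .
  qed
  have shift: "1 + (\<Sum>i\<in>S. of_real \<epsilon> ^ N i * c i) = 1 + of_real (\<epsilon> ^ g) * P c \<epsilon>" for c \<epsilon>
  proof -
    have "of_real \<epsilon> ^ N i * c i = of_real (\<epsilon> ^ g) * (of_real \<epsilon> ^ (N i - g) * c i)" if "i \<in> S" for i
      using N[OF that] by (simp add: mult.assoc[symmetric] power_add[symmetric])
    then have "(\<Sum>i\<in>S. of_real \<epsilon> ^ N i * c i) = (\<Sum>i\<in>S. of_real (\<epsilon> ^ g) * (of_real \<epsilon> ^ (N i - g) * c i))"
      by (rule sum.cong[OF refl])
    then show ?thesis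
      by (simp only: P_def sum_distrib_left)
  qed
  have sq: "(cmod (1 + of_real r * u))\<^sup>2 = 1 + r * (2 * Re u + r * (cmod u)\<^sup>2)" for r u
    unfolding cmod_power2 by (simp add: power2_eq_square algebra_simps)
  have ineq: "2 * Re (P a \<epsilon>) \<le> 2 * Re (P b \<epsilon>) + \<epsilon> ^ g * (cmod (P b \<epsilon>))\<^sup>2" if "0 < \<epsilon>" for \<epsilon>
  proof -
    have "cmod (1 + of_real (\<epsilon> ^ g) * P a \<epsilon>) \<le> cmod (1 + of_real (\<epsilon> ^ g) * P b \<epsilon>)"
      using le[OF that] unfolding shift .
    then have "(cmod (1 + of_real (\<epsilon> ^ g) * P a \<epsilon>))\<^sup>2 \<le> (cmod (1 + of_real (\<epsilon> ^ g) * P b \<epsilon>))\<^sup>2"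
      by (simp add: power_mono)
    then have "2 * Re (P a \<epsilon>) + \<epsilon> ^ g * (cmod (P a \<epsilon>))\<^sup>2 \<le> 2 * Re (P b \<epsilon>) + \<epsilon> ^ g * (cmod (P b \<epsilon>))\<^sup>2"
      unfolding sq using that by simp
    moreover have "0 \<le> \<epsilon> ^ g * (cmod (P a \<epsilon>))\<^sup>2"
      using that by simp
    ultimately show ?thesis
      by linarith
  qed
  have lim: "(P c \<longlongrightarrow> P c 0) (at_right 0)" for c
  proof -
    have "isCont (P c) 0"
      unfolding P_def by (intro continuous_intros)
    then show ?thesis
      by (simp add: isCont_def filterlim_at_split)
  qed
  have "2 * Re (P a 0) \<le> 2 * Re (P b 0) + 0 ^ g * (cmod (P b 0))\<^sup>2"
  proof (rule tendsto_le)
    show "((\<lambda>\<epsilon>. 2 * Re (P b \<epsilon>) + \<epsilon> ^ g * (cmod (P b \<epsilon>))\<^sup>2) \<longlongrightarrow> 2 * Re (P b 0) + 0 ^ g * (cmod (P b 0))\<^sup>2) (at_right 0)"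
      by (intro tendsto_intros lim)
    show "((\<lambda>\<epsilon>. 2 * Re (P a \<epsilon>)) \<longlongrightarrow> 2 * Re (P a 0)) (at_right 0)"
      by (intro tendsto_intros lim)
    show "\<forall>\<^sub>F \<epsilon> in at_right 0. 2 * Re (P a \<epsilon>) \<le> 2 * Re (P b \<epsilon>) + \<epsilon> ^ g * (cmod (P b \<epsilon>))\<^sup>2"
      using ineq by (auto simp: eventually_at_right_less eventually_at_filter intro!: always_eventually)
  qed simp
  then show ?thesis
    using \<open>0 < g\<close> by (simp add: P0 power_0_left)
qed

section \<open>Colour counts of even edge sets of minimal size\<close>

lemma prod_twist_cis:
  assumes "finite F"
  shows "(\<Prod>e\<in>F. twist \<alpha> e (cis \<theta>)) =
    cis ((real (card {e \<in> F. \<alpha> e = 1}) - real (card {e \<in> F. \<alpha> e \<noteq> 1})) * \<theta>)"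
proof -
  have "(\<Prod>e\<in>F. twist \<alpha> e (cis \<theta>)) = cis \<theta> ^ card {e \<in> F. \<alpha> e = 1} * cis (- \<theta>) ^ card {e \<in> F. \<alpha> e \<noteq> 1}"
    unfolding twist_def using assms by (simp add: prod.If_cases Int_def cis_cnj Collect_neg_eq[symmetric])
  then show ?thesis
    by (simp add: Complex.DeMoivre cis_mult algebra_simps)
qed

text \<open>As \<open>|a - b| \<le> a + b = g\<close>, only -1, 0 and 1 are possible for
  \<open>n\<close>; they give \<open>a = 0\<close>, \<open>a = b\<close> and
  \<open>b = 0\<close>.\<close>

lemma eq_zero_or_half_or_one:
  fixes a b g :: nat and n :: int
  assumes "0 < g" "a + b = g" "real a - real b = real_of_int n * real g"
  shows "a = 0 \<or> b = 0 \<or> a = b"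
proof -
  have "real_of_int n * real g \<le> 1 * real g" "(- 1) * real g \<le> real_of_int n * real g"
    using assms by linarith+
  then have "n \<le> 1" "- 1 \<le> n"
    using assms(1) by (simp_all only: mult_le_cancel_right) auto
  then have "n = - 1 \<or> n = 0 \<or> n = 1"
    by linarith
  then show ?thesis
    using assms by auto
qed

text \<open>The inequality controls only the sum of the coefficients of all even sets with
  \<open>g\<close> edges, so these are treated together: every \<open>1 - Re (\<omega> F)\<close> is
  nonnegative, and a nonpositive sum makes each of them vanish.\<close>

lemma even_edges_color_count:
  assumes G: "bipartite_graph A B E" and girth: "girth E = enat g" and g: "0 < g"
    and \<alpha>: "\<alpha> \<in> E \<rightarrow> {0, 1}" and norming: "complex_norming A B E \<alpha>"
    and F: "F \<subseteq> E" "even_edges F" "card F = g"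
  shows "card {e \<in> F. \<alpha> e = 1} = 0 \<or> card {e \<in> F. \<alpha> e \<noteq> 1} = 0 \<or>
    card {e \<in> F. \<alpha> e = 1} = card {e \<in> F. \<alpha> e \<noteq> 1}"
proof -
  \<comment> \<open>This angle gives \<open>z ^ g = 1\<close>, the largest real part that a
    coefficient of modulus 1 can have.\<close>
  define \<theta> where "\<theta> = 2 * pi / real g"
  define z where "z = cis \<theta>"
  define Ev where "Ev = {F. F \<subseteq> E \<and> even_edges F}"
  define S where "S = Ev - {{}}"
  define \<omega> where "\<omega> F = (\<Prod>e\<in>F. twist \<alpha> e z)" for F
  have finV: "finite (A \<union> B)" and EAB: "E \<subseteq> A \<times> B" and AB: "A \<inter> B = {}"
    using G by (auto simp: bipartite_graph_def)
  have finE: "finite E"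
    using G by (auto simp: bipartite_graph_def intro: finite_subset)
  have finS: "finite S"
    using finE by (auto simp: S_def Ev_def)
  have dens: "hom_density (A \<union> B) E 2 (\<lambda>e i j. 1 + of_real \<epsilon> * x e * ((- 1) ^ i * (- 1) ^ j)) =
      1 + (\<Sum>F\<in>S. of_real \<epsilon> ^ card F * (\<Prod>e\<in>F. x e))" for \<epsilon> :: real and x :: "'a \<times> 'a \<Rightarrow> complex"
  proof -
    have "hom_density (A \<union> B) E 2 (\<lambda>e i j. 1 + of_real \<epsilon> * x e * ((- 1) ^ i * (- 1) ^ j)) =
        (\<Sum>F\<in>Ev. of_real \<epsilon> ^ card F * (\<Prod>e\<in>F. x e))"
      unfolding Ev_def using finV finE EAB AB
      by (subst hom_density_rademacher) (auto simp: prod.distrib)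
    also have "\<dots> = 1 + (\<Sum>F\<in>S. of_real \<epsilon> ^ card F * (\<Prod>e\<in>F. x e))"
      unfolding S_def using finE by (subst sum.remove[of Ev "{}"]) (auto simp: Ev_def even_edges_def)
    finally show ?thesis .
  qed
  \<comment> \<open>On the left are the coefficients of the mixed density, on the right those of the
    density of \<open>1 + \<epsilon> z h\<close> alone.\<close>
  have "(\<Sum>F | F \<in> S \<and> card F = g. Re (z ^ card F)) \<le> (\<Sum>F | F \<in> S \<and> card F = g. Re (\<omega> F))"
  proof (rule Re_leading_coeff_le[OF finS g])
    show "g \<le> card F" if "F \<in> S" for F
      using girth_le_card_even_edges[OF finE EAB AB _ _ _ girth] that by (auto simp: S_def Ev_def)
    fix \<epsilon> :: real assume "0 < \<epsilon>"
    \<comment> \<open>The index \<open>s\<close> is a colour; \<open>M 0\<close> is the conjugate of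
      \<open>M 1\<close>.\<close>
    define M where "M s i j = 1 + of_real \<epsilon> * (if s = 1 then z else cnj z) * ((- 1) ^ i * (- 1) ^ j)"
      for s i j :: nat
    have tw: "twist \<alpha> e (M s i j) =
        1 + of_real \<epsilon> * twist \<alpha> e (if s = 1 then z else cnj z) * ((- 1) ^ i * (- 1) ^ j)" for e s i j
      by (simp add: M_def twist_def)
    have one: "hom_density (A \<union> B) E 2 (\<lambda>e i j. twist \<alpha> e (M 1 i j)) = 1 + (\<Sum>F\<in>S. of_real \<epsilon> ^ card F * \<omega> F)"
      unfolding tw dens \<omega>_def by simp
    \<comment> \<open>Conjugating the function conjugates its density, so both colours share one
      bound.\<close>
    have "hom_density (A \<union> B) E 2 (\<lambda>e i j. twist \<alpha> e (M 0 i j)) =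
        cnj (hom_density (A \<union> B) E 2 (\<lambda>e i j. twist \<alpha> e (M 1 i j)))"
      unfolding hom_density_cnj[symmetric] by (simp add: tw twist_cnj)
    then have "cmod (hom_density (A \<union> B) E 2 (\<lambda>e i j. twist \<alpha> e (M 0 i j))) =
        cmod (1 + (\<Sum>F\<in>S. of_real \<epsilon> ^ card F * \<omega> F))"
      by (simp only: complex_mod_cnj one)
    with one have bound: "cmod (hom_density (A \<union> B) E 2 (\<lambda>e i j. twist \<alpha> e (M s i j)))
        \<le> cmod (1 + (\<Sum>F\<in>S. of_real \<epsilon> ^ card F * \<omega> F))" if "s \<in> {0, 1}" for s
      using that by fastforce
    \<comment> \<open>The selection in the Hoelder inequality is \<open>\<alpha>\<close> itself: the
      conjugation in \<open>M (\<alpha> e)\<close> cancels that of \<open>twist\<close> and leaves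
      \<open>z\<close> on every edge.\<close>
    have "cmod (hom_density (A \<union> B) E 2 (\<lambda>e i j. twist \<alpha> e (M (\<alpha> e) i j)))
        \<le> cmod (1 + (\<Sum>F\<in>S. of_real \<epsilon> ^ card F * \<omega> F))"
      using norming \<alpha> unfolding complex_norming_def
      by (intro hom_density_mixed_le[OF G \<alpha> _ _ _ _ bound, where I = "{0, 1}"]) auto
    moreover have "twist \<alpha> e (if \<alpha> e = 1 then z else cnj z) = z" for e
      by (simp add: twist_def)
    ultimately show "cmod (1 + (\<Sum>F\<in>S. of_real \<epsilon> ^ card F * z ^ card F))
        \<le> cmod (1 + (\<Sum>F\<in>S. of_real \<epsilon> ^ card F * \<omega> F))"
      unfolding tw dens by simp
  qed
  moreover have "z ^ g = 1"
    using g by (simp add: z_def \<theta>_def Complex.DeMoivre)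
  ultimately have sum_le: "(\<Sum>F | F \<in> S \<and> card F = g. 1 - Re (\<omega> F)) \<le> 0"
    by (simp add: sum_subtractf cong: conj_cong)
  have "cmod (\<omega> F) = 1" for F
    unfolding \<omega>_def prod_norm[symmetric] by (rule prod.neutral) (simp add: twist_def z_def)
  then have nonneg: "0 \<le> 1 - Re (\<omega> F)" for F
    using complex_Re_le_cmod[of "\<omega> F"] by simp
  have "(\<Sum>F | F \<in> S \<and> card F = g. 1 - Re (\<omega> F)) = 0"
    using sum_le nonneg by (intro antisym sum_nonneg) auto
  then have "\<forall>F\<in>{F \<in> S. card F = g}. 1 - Re (\<omega> F) = 0"
    using finS nonneg by (subst (asm) sum_nonneg_eq_0_iff) auto
  moreover have "F \<in> S"
    using F g by (auto simp: S_def Ev_def)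
  ultimately have "Re (\<omega> F) = 1"
    using F by simp
  moreover have finF: "finite F"
    using F(1) finE finite_subset by blast
  let ?a = "card {e \<in> F. \<alpha> e = 1}" and ?b = "card {e \<in> F. \<alpha> e \<noteq> 1}"
  have "\<omega> F = cis ((real ?a - real ?b) * \<theta>)"
    unfolding \<omega>_def z_def by (rule prod_twist_cis[OF finF])
  ultimately have "cos ((real ?a - real ?b) * \<theta>) = 1"
    by simp
  then obtain n :: int where "(real ?a - real ?b) * \<theta> = real_of_int n * 2 * pi"
    by (auto simp: cos_one_2pi_int)
  then have "pi * (2 * (real ?a - real ?b)) = pi * (2 * (real_of_int n * real g))"
    using g by (simp add: \<theta>_def field_simps)
  then have "real ?a - real ?b = real_of_int n * real g"
    by (simp only: mult_cancel_left) simp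
  moreover have "?a + ?b = g"
    unfolding F(3)[symmetric] using finF by (subst card_Un_disjoint[symmetric]) (auto intro: arg_cong[where f = card])
  ultimately show ?thesis
    using eq_zero_or_half_or_one[OF g] by blast
qed

theorem theorem6p2:
  fixes A B :: "'a set" and E :: "('a \<times> 'a) set" and \<alpha> :: "'a \<times> 'a \<Rightarrow> nat" and g :: nat
  assumes "bipartite_graph A B E"
    and "girth E = enat g"
    and "\<alpha> \<in> E \<rightarrow> {0, 1}"
    and "complex_norming A B E \<alpha>"
  shows "\<forall>c. is_cycle E c \<and> length c = g \<longrightarrow>
           (\<exists>k. \<forall>e\<in>cycle_edges E c. \<alpha> e = k) \<or>
           (\<forall>k\<in>{0, 1}. real (card {e \<in> cycle_edges E c. \<alpha> e = k}) = real g / 2)"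
proof (intro allI impI, elim conjE)
  fix c assume c: "is_cycle E c" and len: "length c = g"
  let ?F = "cycle_edges E c"
  let ?a = "card {e \<in> ?F. \<alpha> e = 1}" and ?b = "card {e \<in> ?F. \<alpha> e \<noteq> 1}"
  have EAB: "E \<subseteq> A \<times> B" and AB: "A \<inter> B = {}"
    using assms(1) by (auto simp: bipartite_graph_def)
  have FE: "?F \<subseteq> E"
    by (auto simp: cycle_edges_def)
  have g: "0 < g"
    using c len by (auto simp: is_cycle_def)
  have card: "card ?F = g"
    using card_cycle_edges[OF c EAB AB] len by simp
  have fin: "finite ?F"
    using card g by (simp add: card_ge_0_finite)
  \<comment> \<open>\<open>\<alpha>\<close> takes only the values 0 and 1 on \<open>E\<close>, so
    \<open>?b\<close> counts the edges of colour 0.\<close>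
  have zero: "\<alpha> e \<noteq> 1 \<longleftrightarrow> \<alpha> e = 0" if "e \<in> ?F" for e
    using funcset_mem[OF assms(3), of e] FE that by auto
  have sum: "?a + ?b = g"
    unfolding card[symmetric] using fin by (subst card_Un_disjoint[symmetric]) (auto intro: arg_cong[where f = card])
  have b: "?b = card {e \<in> ?F. \<alpha> e = 0}"
    using zero by (intro arg_cong[where f = card]) auto
  have "?a = 0 \<or> ?b = 0 \<or> ?a = ?b"
    using even_edges_color_count[OF assms(1,2) g assms(3,4) FE even_edges_cycle[OF c EAB AB] card] .
  then show "(\<exists>k. \<forall>e\<in>?F. \<alpha> e = k) \<or> (\<forall>k\<in>{0, 1}. real (card {e \<in> ?F. \<alpha> e = k}) = real g / 2)"
  proof (elim disjE)
    assume "?a = 0"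
    then have "\<forall>e\<in>?F. \<alpha> e = 0"
      using fin zero by auto
    then show ?thesis
      by blast
  next
    assume "?b = 0"
    then have "\<forall>e\<in>?F. \<alpha> e = 1"
      using fin by auto
    then show ?thesis
      by blast
  next
    assume "?a = ?b"
    then have "real ?a = real g / 2" "real ?b = real g / 2"
      using sum by simp_all
    then show ?thesis
      using b by auto
  qed
qed

end
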